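(* Let $\mathscr L$ be a lattice (bounded, distributive, with $0\neq1$) that admits a positively expansive automorphism. Then there exists $N\in\mathbb N$ such that every cover of $\mathscr L$ has a subcover with at most $N$ members. In particular, $\mathscr L$ has finitely many proper maximal elements.
   Context: Throughout, "lattice" means a bounded distributive lattice $\mathscr L$ (partially ordered by $\leq$, with join $\sqcup$, meet $\sqcap$, minimum $0$ and maximum $1$) such that $0\neq 1$. $\mathbb N=\{0,1,2,\dots\}$. A cover of $\mathscr L$ is a finite subset $\mathscr U\subseteq\mathscr L$ with $\bigsqcup\mathscr U=1$ (the join of its elements, $\bigsqcup\varnothing=0$); $\mathscr C(\mathscr L)$ is the set of all covers. A subcover of a cover $\mathscr U$ is a cover $\mathscr V$ with $\mathscr V\subseteq\mathscr U$. For $\mathscr U,\mathscr V\subseteq\mathscr L$: $\mathscr U\prec\mathscr V$ means that for every $u\in\mathscr U$ there is $v\in\mathscr V$ with $u\leq v$; and $\mathscr U\wedge\mathscr V=\{u\sqcap v:u\in\mathscr U,v\in\mathscr V\}$ (an associative and commutative operation; $\bigwedge$ denotes its iteration over a finite nonempty index set). An automorphism of $\mathscr L$ is a bijection $\lambda\colon\mathscr L\to\mathscr L$ preserving $\sqcup$ and $\sqcap$; $\lambda\mathscr U=\{\lambda u:u\in\mathscr U\}$, and $\lambda^n$ denotes the iterates of $\lambda$. An automorphism $\lambda$ is positively expansive if there is a cover $\mathscr U\in\mathscr C(\mathscr L)$ such that for every $\mathscr V\in\mathscr C(\mathscr L)$ there exists $N\in\mathbb N$ with $\bigwedge_{n=0}^{N}\lambda^n\mathscr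 U\prec\mathscr V$. An element $u\in\mathscr L$ is a proper maximal element if $u\neq1$ and, for all $v\in\mathscr L$, $u\leq v$ implies $v=u$ or $v=1$. *)

theory Defs
  imports Main
begin

text \<open>
  The lattice is the universe of a type of sort \<open>{distrib_lattice, bounded_lattice}\<close>.
  That sort does not exclude the one-element lattice, so the condition \<open>bot \<noteq> top\<close> has
  to be assumed separately.
\<close>

text \<open>
  Adding \<open>bot\<close> makes \<open>Sup_fin\<close>, which is meant for nonempty finite sets, return \<open>bot\<close>
  on the empty set and changes nothing on nonempty finite sets.
\<close>
definition finite_join :: "'a::bounded_lattice set \<Rightarrow> 'a" where
  "finite_join U = Sup_fin (insert bot U)"

lemma finite_join_empty [simp]: "finite_join {} = bot"
  by (simp add: finite_join_def)

lemma finite_join_insert: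
  fixes x :: "'a::bounded_lattice"
  assumes "finite U"
  shows "finite_join (insert x U) = sup x (finite_join U)"
  using assms by (simp add: finite_join_def insert_commute [of bot x])

definition covers :: "'a::bounded_lattice set set" where
  "covers = {U. finite U \<and> finite_join U = top}"

definition subcover :: "'a::bounded_lattice set \<Rightarrow> 'a set \<Rightarrow> bool" where
  "subcover V U \<longleftrightarrow> V \<in> covers \<and> V \<subseteq> U"

definition refines :: "'a::order set \<Rightarrow> 'a set \<Rightarrow> bool" where
  "refines U V \<longleftrightarrow> (\<forall>u\<in>U. \<exists>v\<in>V. u \<le> v)"

definition set_meet :: "'a::lattice set \<Rightarrow> 'a set \<Rightarrow> 'a set" where
  "set_meet U V = {inf u v | u v. u \<in> U \<and> v \<in> V}"

text \<open>
  The iterated \<open>set_meet\<close> of \<open>U 0, \<dots>, U N\<close>, with the upper index included.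
  As \<open>set_meet\<close> is not idempotent, repeated members of the family count with multiplicity.
\<close>
primrec set_meets :: "(nat \<Rightarrow> 'a::lattice set) \<Rightarrow> nat \<Rightarrow> 'a set" where
  "set_meets U 0 = U 0"
| "set_meets U (Suc N) = set_meet (set_meets U N) (U (Suc N))"

definition lattice_automorphism :: "('a::lattice \<Rightarrow> 'a) \<Rightarrow> bool" where
  "lattice_automorphism f \<longleftrightarrow>
     bij f \<and> (\<forall>x y. f (sup x y) = sup (f x) (f y)) \<and> (\<forall>x y. f (inf x y) = inf (f x) (f y))"

definition positively_expansive :: "('a::bounded_lattice \<Rightarrow> 'a) \<Rightarrow> bool" where
  "positively_expansive f \<longleftrightarrow>
     (\<exists>U\<in>covers. \<forall>V\<in>covers. \<exists>N::nat. refines (set_meets (\<lambda>n. (f ^^ n) ` U) N) V)"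

definition proper_maximal :: "'a::bounded_lattice \<Rightarrow> bool" where
  "proper_maximal u \<longleftrightarrow> u \<noteq> top \<and> (\<forall>v. u \<le> v \<longrightarrow> v = u \<or> v = top)"

end

(*
  Let U be an expansivity cover and W_n the meet of f^i U for i \<le> n. Since the preimage of U
  under f is a cover too, expansivity gives N with f W_N \<prec> U, hence f W_N \<prec> W_N,
  and so f^k W_N \<prec> W_N for all k. Therefore f^M W_N \<prec> W_M for every M. As any cover is
  refined by some W_M, it is refined by a cover with at most |W_N| members, and so has a subcover
  of at most that size. For a finite nonempty set A of proper maximal elements, the meets of the sets
  A - {a}, a \<in> A, form a cover all of whose subcovers have at least |A| members.
*)
theory Submission
  imports Defs
begin

section \<open>Finite joins and covers\<close>

lemma finite_join_le_iff:
  assumes "finite U"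
  shows "finite_join U \<le> x \<longleftrightarrow> (\<forall>u\<in>U. u \<le> x)"
  using assms by (induction U rule: finite_induct) (auto simp: finite_join_insert)

lemma finite_join_upper:
  assumes "finite U" "u \<in> U"
  shows "u \<le> finite_join U"
  using finite_join_le_iff [OF assms(1), of "finite_join U"] assms(2) by simp

lemma inf_finite_join:
  fixes x :: "'a::{distrib_lattice, bounded_lattice}"
  assumes "finite U"
  shows "inf x (finite_join U) = finite_join (inf x ` U)"
  using assms
  by (induction U rule: finite_induct) (simp_all add: finite_join_insert inf_sup_distrib1)

text \<open>Every member of \<open>U\<close> lies below some member of \<open>V\<close>, so the join
  of \<open>V\<close> dominates that of \<open>U\<close>.\<close>

lemma covers_refines:
  assumes "U \<in> covers" "finite V" "refines U V"
  shows "V \<in> covers"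
proof -
  have "finite U" "finite_join U = top"
    using assms(1) by (auto simp: covers_def)
  moreover have "\<forall>u\<in>U. u \<le> finite_join V"
    using assms(2,3) by (meson finite_join_upper order_trans refines_def)
  ultimately have "top \<le> finite_join V"
    by (metis finite_join_le_iff)
  then show ?thesis
    using assms(2) by (simp add: covers_def top_unique)
qed

lemma finite_set_meet:
  assumes "finite U" "finite V"
  shows "finite (set_meet U V)"
proof -
  have "set_meet U V = (\<lambda>(u, v). inf u v) ` (U \<times> V)"
    by (auto simp: set_meet_def)
  then show ?thesis
    using assms by simp
qed

lemma set_meet_covers:
  fixes U V :: "'a::{distrib_lattice, bounded_lattice} set"
  assumes "U \<in> covers" "V \<in> covers"
  shows "set_meet U V \<in> covers"
proof -
  have U: "finite U" "finite_join U = top" and V: "finite V" "finite_join V = top"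
    using assms by (auto simp: covers_def)
  have fin: "finite (set_meet U V)"
    by (rule finite_set_meet) fact+
  have "u \<le> finite_join (set_meet U V)" if "u \<in> U" for u
  proof -
    \<comment> \<open>Distributivity expands \<open>inf u top\<close>, with \<open>top\<close>
      written as the join of \<open>V\<close>.\<close>
    have "u = finite_join (inf u ` V)"
      using V by (metis inf_finite_join inf_top_right)
    also have "\<dots> \<le> finite_join (set_meet U V)"
      using V(1) fin that
      by (auto simp: finite_join_le_iff set_meet_def intro!: finite_join_upper)
    finally show ?thesis .
  qed
  then have "top \<le> finite_join (set_meet U V)"
    using U by (metis finite_join_le_iff)
  then show ?thesis
    using fin by (simp add: covers_def top_unique)
qed

lemma set_meets_covers:
  fixes U :: "nat \<Rightarrow> 'a::{distrib_lattice, bounded_lattice} set"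
  assumes "\<And>i. i \<le> n \<Longrightarrow> U i \<in> covers"
  shows "set_meets U n \<in> covers"
  using assms by (induction n) (simp_all add: set_meet_covers)

section \<open>The refinement preorder\<close>

lemma refines_refl: "refines U U"
  by (auto simp: refines_def)

lemma refines_trans:
  assumes "refines U V" "refines V W"
  shows "refines U W"
  using assms unfolding refines_def by (meson order_trans)

lemma refines_image:
  assumes "mono f" "refines U V"
  shows "refines (f ` U) (f ` V)"
  using assms unfolding refines_def by (metis imageE imageI monoD)

text \<open>In the refinement preorder \<open>set_meet\<close> is a greatest lower bound. Refinement
  into an iterated meet can therefore be checked factor by factor, and multiplicities do not
  matter.\<close>

lemma refines_set_meet_iff: "refines X (set_meet U V) \<longleftrightarrow> refines X U \<and> refines X V"
proof
  assume L: "refines X (set_meet U V)"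
  have "refines (set_meet U V) U" "refines (set_meet U V) V"
    by (auto simp: refines_def set_meet_def intro: inf.coboundedI1 inf.coboundedI2)
  with L show "refines X U \<and> refines X V"
    using refines_trans by blast
next
  assume R: "refines X U \<and> refines X V"
  show "refines X (set_meet U V)"
    unfolding refines_def
  proof
    fix x assume "x \<in> X"
    then obtain u v where "u \<in> U" "v \<in> V" "x \<le> u" "x \<le> v"
      using R unfolding refines_def by blast
    then have "inf u v \<in> set_meet U V" "x \<le> inf u v"
      by (auto simp: set_meet_def)
    then show "\<exists>w\<in>set_meet U V. x \<le> w" ..
  qed
qed

lemma refines_set_meets_iff: "refines X (set_meets U n) \<longleftrightarrow> (\<forall>i\<le>n. refines X (U i))"
  by (induction n) (auto simp: refines_set_meet_iff le_Suc_eq)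

section \<open>Automorphisms acting on covers\<close>

lemma lattice_automorphism_mono:
  assumes "lattice_automorphism f"
  shows "mono f"
  using assms by (metis lattice_automorphism_def le_iff_sup monoI)

lemma lattice_automorphism_funpow:
  assumes "lattice_automorphism f"
  shows "lattice_automorphism (f ^^ n)"
  using assms by (induction n) (auto simp: lattice_automorphism_def bij_comp)

lemma lattice_automorphism_inv:
  assumes "lattice_automorphism f"
  shows "lattice_automorphism (inv f)"
proof -
  have "bij f"
    using assms by (simp add: lattice_automorphism_def)
  then have f_inv: "f (inv f x) = x" and inv_f: "inv f (f x) = x" for x
    by (simp_all add: bij_is_surj surj_f_inv_f bij_is_inj)
  have "inv f (sup x y) = sup (inv f x) (inv f y)"
    and "inv f (inf x y) = inf (inv f x) (inv f y)" for x y
    using inv_f [of "sup (inv f x) (inv f y)"] inv_f [of "inf (inv f x) (inv f y)"] assms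
    by (simp_all add: lattice_automorphism_def f_inv)
  with \<open>bij f\<close> show ?thesis
    by (simp add: lattice_automorphism_def bij_imp_bij_inv)
qed

lemma lattice_automorphism_covers:
  fixes f :: "'a::bounded_lattice \<Rightarrow> 'a"
  assumes "lattice_automorphism f" "U \<in> covers"
  shows "f ` U \<in> covers"
proof -
  have sup: "f (sup x y) = sup (f x) (f y)" for x y
    using assms(1) by (simp add: lattice_automorphism_def)
  have inv: "f (inv f x) = x" for x
    using assms(1) by (simp add: lattice_automorphism_def bij_is_surj surj_f_inv_f)
  have "mono f"
    by (rule lattice_automorphism_mono) fact
  \<comment> \<open>Automorphisms are only assumed to preserve \<open>sup\<close> and
    \<open>inf\<close>. That the bounds are fixed follows from monotonicity and surjectivity, since
    both bounds are values of \<open>f\<close>.\<close>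
  have bot: "f bot = bot"
    using monoD [OF \<open>mono f\<close>, of bot "inv f bot"] by (simp add: inv bot_unique)
  have top: "f top = top"
    using monoD [OF \<open>mono f\<close>, of "inv f top" top] by (simp add: inv top_unique)
  have U: "finite U" "finite_join U = top"
    using assms(2) by (auto simp: covers_def)
  have "finite_join (f ` U) = f (finite_join U)"
    using U(1) by (induction U rule: finite_induct) (simp_all add: finite_join_insert sup bot)
  with U top show ?thesis
    by (simp add: covers_def)
qed

section \<open>Expansivity bounds the size of subcovers\<close>

lemma refines_imp_small_subcover:
  assumes "W \<in> covers" "V \<in> covers" "refines W V"
  shows "\<exists>V'. subcover V' V \<and> card V' \<le> card W"
proof -
  \<comment> \<open>One member of \<open>V\<close> is chosen above each member of \<open>W\<close>;
    the chosen ones form the subcover.\<close>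
  obtain g where g: "\<And>w. w \<in> W \<Longrightarrow> g w \<in> V \<and> w \<le> g w"
    using assms(3) by (metis refines_def)
  have fin: "finite W"
    using assms(1) by (simp add: covers_def)
  have "refines W (g ` W)"
    using g by (auto simp: refines_def)
  then have "g ` W \<in> covers"
    using assms(1) fin covers_refines by blast
  then show ?thesis
    using g fin by (intro exI [of _ "g ` W"]) (auto simp: subcover_def card_image_le)
qed

lemma positively_expansive_bounded_subcovers:
  fixes f :: "'a::{distrib_lattice, bounded_lattice} \<Rightarrow> 'a"
  assumes f: "lattice_automorphism f" and "positively_expansive f"
  shows "\<exists>N::nat. \<forall>V\<in>(covers :: 'a set set). \<exists>V'. subcover V' V \<and> card V' \<le> N"
proof -
  obtain U :: "'a set" where U: "U \<in> covers"
    and exp: "\<And>V. V \<in> covers \<Longrightarrow> \<exists>N. refines (set_meets (\<lambda>n. (f ^^ n) ` U) N) V"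
    using assms(2) by (auto simp: positively_expansive_def)
  define W where "W = set_meets (\<lambda>n. (f ^^ n) ` U)"
  have mono: "mono (f ^^ n)" for n
    using f by (intro lattice_automorphism_mono lattice_automorphism_funpow)
  have W_le: "refines (W n) ((f ^^ i) ` U)" if "i \<le> n" for i n
    using refines_refl [of "W n"] that by (simp add: W_def refines_set_meets_iff)
  \<comment> \<open>Expansivity is applied to the preimage of \<open>U\<close> so that shifting by
    \<open>f\<close> lands in \<open>U\<close> itself, the factor of index 0 in
    \<open>W N\<close>.\<close>
  obtain N where "refines (W N) (inv f ` U)"
    using exp [OF lattice_automorphism_covers [OF lattice_automorphism_inv [OF f] U]]
    by (auto simp: W_def)
  then have "refines (f ` W N) (f ` inv f ` U)"
    using mono [of 1] by (intro refines_image) simp_all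
  moreover have "f ` inv f ` U = U"
    using f by (simp add: lattice_automorphism_def image_f_inv_f bij_is_surj)
  ultimately have step0: "refines (f ` W N) U"
    by simp
  \<comment> \<open>Only index 0 needs \<open>step0\<close>; a factor of index \<open>Suc j\<close>
    is the \<open>f\<close>-image of the factor of index \<open>j\<close>, which \<open>W N\<close>
    already refines.\<close>
  have "refines (f ` W N) ((f ^^ i) ` U)" if "i \<le> N" for i
  proof (cases i)
    case 0
    then show ?thesis
      using step0 by simp
  next
    case (Suc j)
    have "refines (f ` W N) (f ` (f ^^ j) ` U)"
      using mono [of 1] W_le [of j N] that Suc by (intro refines_image) simp_all
    then show ?thesis
      by (simp add: Suc image_comp)
  qed
  then have step: "refines (f ` W N) (W N)"
    by (simp add: W_def refines_set_meets_iff)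
  have iter: "refines ((f ^^ k) ` W N) (W N)" for k
  proof (induction k)
    case 0
    then show ?case
      by (simp add: refines_refl)
  next
    case (Suc k)
    then have "refines (f ` (f ^^ k) ` W N) (f ` W N)"
      using mono [of 1] by (intro refines_image) simp_all
    with step show ?case
      by (simp add: image_comp refines_trans)
  qed
  have final: "refines ((f ^^ M) ` W N) (W M)" for M
  proof -
    have "refines ((f ^^ M) ` W N) ((f ^^ i) ` U)" if "i \<le> M" for i
    proof -
      \<comment> \<open>Split \<open>M\<close> as \<open>i + (M - i)\<close>: by \<open>iter\<close>
        the inner image refines \<open>W N\<close>, hence its factor \<open>U\<close> of index 0,
        and \<open>f ^^ i\<close> preserves refinement.\<close>
      have "refines ((f ^^ i) ` (f ^^ (M - i)) ` W N) ((f ^^ i) ` U)"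
        using refines_trans [OF iter [of "M - i"] W_le [of 0 N]]
        by (intro refines_image mono) simp
      then show ?thesis
        using that by (simp add: image_comp flip: funpow_add)
    qed
    then show ?thesis
      by (simp add: W_def refines_set_meets_iff)
  qed
  have W_cov: "W N \<in> covers"
    unfolding W_def using f U
    by (intro set_meets_covers lattice_automorphism_covers lattice_automorphism_funpow)
  have "\<exists>V'. subcover V' V \<and> card V' \<le> card (W N)" if V: "V \<in> covers" for V :: "'a set"
  proof -
    obtain M where "refines (W M) V"
      using exp [OF V] by (auto simp: W_def)
    then have "refines ((f ^^ M) ` W N) V"
      using final refines_trans by blast
    moreover have "(f ^^ M) ` W N \<in> covers"
      using f W_cov by (intro lattice_automorphism_covers lattice_automorphism_funpow)
    ultimately obtain V' where "subcover V' V" "card V' \<le> card ((f ^^ M) ` W N)"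
      using V refines_imp_small_subcover by blast
    \<comment> \<open>\<open>M\<close> depends on \<open>V\<close>, but the size of the image is
      bounded independently of \<open>M\<close>.\<close>
    moreover have "card ((f ^^ M) ` W N) \<le> card (W N)"
      using W_cov by (simp add: covers_def card_image_le)
    ultimately show ?thesis
      by (meson order_trans)
  qed
  then show ?thesis
    by blast
qed

section \<open>Finite meets and proper maximal elements\<close>

definition finite_meet :: "'a::bounded_lattice set \<Rightarrow> 'a" where
  "finite_meet A = Inf_fin (insert top A)"

lemma finite_meet_empty: "finite_meet {} = top"
  by (simp add: finite_meet_def)

lemma finite_meet_insert:
  fixes x :: "'a::bounded_lattice"
  assumes "finite A"
  shows "finite_meet (insert x A) = inf x (finite_meet A)"
  using assms by (simp add: finite_meet_def insert_commute [of top x])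

lemma finite_meet_lower:
  assumes "finite A" "a \<in> A"
  shows "finite_meet A \<le> a"
  using assms by (simp add: finite_meet_def Inf_fin.coboundedI)

lemma sup_finite_meet_eq_top:
  fixes b :: "'a::{distrib_lattice, bounded_lattice}"
  assumes "finite A" "\<And>a. a \<in> A \<Longrightarrow> sup b a = top"
  shows "sup b (finite_meet A) = top"
  using assms
  by (induction A rule: finite_induct)
    (simp_all add: finite_meet_empty finite_meet_insert sup_inf_distrib1)

text \<open>This is the lattice form of the ring-theoretic fact that, for pairwise comaximal ideals,
  the intersections omitting one ideal each sum to the unit ideal.\<close>

lemma comaximal_covers:
  fixes A :: "'a::{distrib_lattice, bounded_lattice} set"
  assumes "finite A" "A \<noteq> {}"
    and "\<And>a b. a \<in> A \<Longrightarrow> b \<in> A \<Longrightarrow> a \<noteq> b \<Longrightarrow> sup a b = top"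
  shows "(\<lambda>a. finite_meet (A - {a})) ` A \<in> covers"
  using assms
proof (induction A rule: finite_ne_induct)
  case (singleton a)
  \<comment> \<open>Here \<open>A - {a}\<close> is empty, and its meet is \<open>top\<close> by the
    convention in \<open>finite_meet\<close>.\<close>
  show ?case
    by (simp add: covers_def finite_meet_empty finite_join_insert)
next
  case (insert b A)
  let ?J = "(\<lambda>a. finite_meet (A - {a})) ` A"
  let ?s = "finite_join ((\<lambda>a. finite_meet (insert b A - {a})) ` insert b A)"
  have J: "finite ?J" "finite_join ?J = top"
    using insert by (auto simp: covers_def)
  have upper: "finite_meet (insert b A - {a}) \<le> ?s" if "a \<in> insert b A" for a
    using insert.hyps that by (intro finite_join_upper) auto
  \<comment> \<open>For \<open>a\<close> in \<open>A\<close> the new meet is \<open>b\<close> met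
    with the old one. The old meets join to \<open>top\<close> by induction, so by distributivity
    the new ones join to \<open>b\<close>.\<close>
  have "inf b (finite_meet (A - {a})) \<le> ?s" if "a \<in> A" for a
  proof -
    have "insert b A - {a} = insert b (A - {a})"
      using that insert.hyps by auto
    then show ?thesis
      using upper [of a] that insert.hyps by (simp add: finite_meet_insert)
  qed
  then have "finite_join (inf b ` ?J) \<le> ?s"
    using J by (subst finite_join_le_iff) auto
  then have "b \<le> ?s"
    using inf_finite_join [OF J(1), of b] J(2) by simp
  \<comment> \<open>This is the member of the new family that omits \<open>b\<close>.\<close>
  moreover have "finite_meet A \<le> ?s"
    using upper [of b] insert.hyps by simp
  moreover have "sup b (finite_meet A) = top"
    using insert.hyps insert.prems by (intro sup_finite_meet_eq_top) auto
  ultimately have "?s = top"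
    by (metis sup.bounded_iff top_unique)
  then show ?case
    using insert.hyps by (simp add: covers_def)
qed

text \<open>A join different from \<open>top\<close> would have to equal both \<open>a\<close> and
  \<open>b\<close>.\<close>

lemma proper_maximal_sup_eq_top:
  assumes "proper_maximal a" "proper_maximal b" "a \<noteq> b"
  shows "sup a b = top"
  using assms unfolding proper_maximal_def by (metis sup.cobounded1 sup.cobounded2)

text \<open>For each \<open>a\<close> the subcover needs a member not below \<open>a\<close>, and
  only the meet omitting \<open>a\<close> qualifies. Different \<open>a\<close> thus force different
  members.\<close>

lemma card_proper_maximal_le_card_subcover:
  fixes A :: "'a::bounded_lattice set"
  assumes A: "finite A" "\<And>a. a \<in> A \<Longrightarrow> proper_maximal a"
    and V: "subcover V ((\<lambda>a. finite_meet (A - {a})) ` A)"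
  shows "card A \<le> card V"
proof -
  have fin: "finite V" and top: "finite_join V = top"
    and sub: "V \<subseteq> (\<lambda>a. finite_meet (A - {a})) ` A"
    using V by (auto simp: subcover_def covers_def)
  \<comment> \<open>Otherwise the join of \<open>V\<close>, which is \<open>top\<close>, would lie
    below \<open>a\<close>.\<close>
  have "\<exists>v\<in>V. \<not> v \<le> a" if "a \<in> A" for a
    using A(2) [OF that] fin top
    by (metis finite_join_le_iff proper_maximal_def top_unique)
  then obtain g where g: "\<And>a. a \<in> A \<Longrightarrow> g a \<in> V \<and> \<not> g a \<le> a"
    by metis
  have le: "finite_meet (A - {b}) \<le> a" if "a \<in> A" "b \<noteq> a" for a b
    using that A(1) by (intro finite_meet_lower) auto
  have g_eq: "g a = finite_meet (A - {a})" if a: "a \<in> A" for a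
  proof -
    obtain b where "b \<in> A" "g a = finite_meet (A - {b})"
      using g [OF a] sub by auto
    with g [OF a] le [OF a] show ?thesis
      by metis
  qed
  \<comment> \<open>If \<open>g a = g b\<close> with \<open>a\<close> and \<open>b\<close> distinct,
    then \<open>g b\<close>, the meet omitting \<open>b\<close>, lies below \<open>a\<close>,
    whereas \<open>g a\<close> does not.\<close>
  have "inj_on g A"
    using g g_eq le by (metis inj_onI)
  then show ?thesis
    using g fin by (intro card_inj_on_le [of g]) auto
qed

theorem theorem4p4:
  assumes "(bot :: 'a::{distrib_lattice, bounded_lattice}) \<noteq> top"
    and "\<exists>f :: 'a \<Rightarrow> 'a. lattice_automorphism f \<and> positively_expansive f"
  shows "(\<exists>N::nat. \<forall>U \<in> (covers :: 'a set set). \<exists>V. subcover V U \<and> card V \<le> N)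
    \<and> finite {u :: 'a. proper_maximal u}"
proof -
  obtain N :: nat where N: "\<forall>U \<in> (covers :: 'a set set). \<exists>V. subcover V U \<and> card V \<le> N"
    using assms(2) positively_expansive_bounded_subcovers by blast
  have "finite {u :: 'a. proper_maximal u}"
  proof (rule ccontr)
    assume "infinite {u :: 'a. proper_maximal u}"
    \<comment> \<open>The size \<open>Suc N\<close> exceeds the bound and also makes
      \<open>A\<close> nonempty, as \<open>comaximal_covers\<close> requires.\<close>
    then obtain A :: "'a set" where A: "finite A" "card A = Suc N" "A \<subseteq> {u. proper_maximal u}"
      using infinite_arbitrarily_large by blast
    have "(\<lambda>a. finite_meet (A - {a})) ` A \<in> covers"
      using A by (intro comaximal_covers proper_maximal_sup_eq_top) auto
    then obtain V where "subcover V ((\<lambda>a. finite_meet (A - {a})) ` A)" "card V \<le> N"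
      using N by blast
    with card_proper_maximal_le_card_subcover [of A V] A show False
      by auto
  qed
  with N show ?thesis
    by blast
qed

end
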